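(* Fix a token position $(d,i)$, write $v=w_{d,i}$, and let $q(\mathbf z^{\setminus d,i})=\prod_{(d',j)\neq(d,i)}q(z_{d',j})$ be a fixed fully factorized probability distribution on $\mathbf z^{\setminus d,i}$. All expectations below are with respect to $q(\mathbf z^{\setminus d,i})$. Let $\alpha\in\mathbb R\setminus\{0\}$. (1) For any functions $b,c:\{1,\dots,T\}\to(0,\infty)$, let $q^{\setminus a_{d,i}}(\mathbf z)=b(z_{d,i})\,c(z_{d,i})\,q(\mathbf z^{\setminus d,i})$. The minimizer over functions $a:\{1,\dots,T\}\to(0,\infty)$ of $$D_\alpha\Big[(n_{d,z_{d,i}}^{\setminus d,i}+\gamma_{z_{d,i}})\,q^{\setminus a_{d,i}}(\mathbf z)\ \Big\|\ a(z_{d,i})\,q^{\setminus a_{d,i}}(\mathbf z)\Big]$$ is $a^*(t)=\mathbb E\big[(n_{d,t}^{\setminus d,i}+\gamma_t)^\alpha\big]^{1/\alpha}$, $t=1,\dots,T$. (2) For any functions $a,c:\{1,\dots,T\}\to(0,\infty)$, let $q^{\setminus b_{d,i}}(\mathbf z)=a(z_{d,i})\,c(z_{d,i})\,q(\mathbf z^{\setminus d,i})$. The minimizer over functions $b:\{1,\dots,T\}\to(0,\infty)$ of $$D_\alpha\Big[(n_{z_{d,i},v}^{\setminus d,i}+\beta)\,q^{\setminus b_{d,i}}(\mathbf z)\ \Big\|\ b(z_{d,i})\,q^{\setminus b_{d,i}}(\mathbf z)\Big]$$ is $b^*(t)=\mathbb E\big[(n_{t,v}^{\setminus d,i}+\beta)^\alpha\big]^{1/\alpha}$,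 $t=1,\dots,T$. (3) For any functions $a,b:\{1,\dots,T\}\to(0,\infty)$, let $q^{\setminus c_{d,i}}(\mathbf z)=a(z_{d,i})\,b(z_{d,i})\,q(\mathbf z^{\setminus d,i})$. The minimizer over functions $c:\{1,\dots,T\}\to(0,\infty)$ of $$D_\alpha\Big[\frac{1}{n_{z_{d,i},\cdot}^{\setminus d,i}+V\beta}\,q^{\setminus c_{d,i}}(\mathbf z)\ \Big\|\ c(z_{d,i})\,q^{\setminus c_{d,i}}(\mathbf z)\Big]$$ is $c^*(t)=\mathbb E\Big[\Big(\frac{1}{n_{t,\cdot}^{\setminus d,i}+V\beta}\Big)^\alpha\Big]^{1/\alpha}$, $t=1,\dots,T$. (4) Let $a^{(\alpha=1)}$ and $b^{(\alpha=1)}$ be the minimizers in (1) and (2) for $\alpha=1$, and let $c^{(\alpha=-1)}$ be the minimizer in (3) for $\alpha=-1$. Then the update $$q(z_{d,i}=t)\propto a^{(\alpha=1)}(t)\,b^{(\alpha=1)}(t)\,c^{(\alpha=-1)}(t)$$ is the CVB0 update, i.e. $$a^{(\alpha=1)}(t)\,b^{(\alpha=1)}(t)\,c^{(\alpha=-1)}(t)=\big(\mathbb E[n_{d,t}^{\setminus d,i}]+\gamma_t\big)\,\frac{\mathbb E[n_{t,v}^{\setminus d,i}]+\beta}{\mathbb E[n_{t,\cdot}^{\setminus d,i}]+V\beta}\qquad\text{for every }t\in\{1,\dots,T\}.$$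
   Context: Setting (latent Dirichlet allocation with parameters marginalized out). There are $N$ documents, a vocabulary $\{1,\dots,V\}$ and topics $\{1,\dots,T\}$. Document $d$ has $n_d$ tokens; its $j$-th token is the fixed observed word $w_{d,j}\in\{1,\dots,V\}$, and it carries a latent topic $z_{d,j}\in\{1,\dots,T\}$. Write $\mathbf z$ for the collection of all $z_{d,j}$, and $\mathbf z^{\setminus d,i}$ for $\mathbf z$ with $z_{d,i}$ removed. The Dirichlet hyperparameters are $\gamma_1,\dots,\gamma_T>0$ and $\beta>0$. Counts with token $(d,i)$ excluded (these are functions of $\mathbf z^{\setminus d,i}$): $n_{d,t}^{\setminus d,i}$ is the number of $j\neq i$ with $z_{d,j}=t$; $n_{t,v}^{\setminus d,i}$ is the number of token positions $(d',j)\neq(d,i)$ in the whole corpus with $w_{d',j}=v$ and $z_{d',j}=t$; $n_{t,\cdot}^{\setminus d,i}=\sum_{v=1}^V n_{t,v}^{\setminus d,i}$. $\alpha$-divergence: for nonnegative, not necessarily normalized, functions $p,q$ on the finite set of all topic assignments $\mathbf z$ having the same support, and $\alpha\in\mathbb R\setminus\{0,1\}$, $$D_\alpha[p\|q]=\frac{\sum_{\mathbf z}\big(\alpha p(\mathbf z)+(1-\alpha)q(\mathbf z)-p(\mathbf z)^\alpha q(\mathbf z)^{1-\alpha}\big)}{\alpha(1-\alpha)},$$ where the sum is over the common support of $p$ and $q$; for $\alpha=1$ it is defined by the limit $\alpha\to1$, which is the unnormalized Kullback–Leibler divergence $$D_1[p\|q]=\sum_{\mathbf z}p(\mathbf z)\log\frac{p(\mathbf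 z)}{q(\mathbf z)}+\sum_{\mathbf z}\big(q(\mathbf z)-p(\mathbf z)\big).$$ CVB0 update (collapsed variational Bayes inference with zero-order Taylor approximation): with $v=w_{d,i}$, $$q(z_{d,i}=t)\propto\frac{\beta+\mathbb E[n_{t,v}^{\setminus d,i}]}{V\beta+\mathbb E[n_{t,\cdot}^{\setminus d,i}]}\,\big(\gamma_t+\mathbb E[n_{d,t}^{\setminus d,i}]\big),$$ with expectations under $q(\mathbf z^{\setminus d,i})$. The symbol $\propto$ means equality up to a normalizing constant independent of $t$. *)

theory Defs
  imports "HOL-Probability.Probability"
begin

section \<open>Corpus, topic assignments and counts\<close>

type_synonym token = "nat \<times> nat"

definition tokens :: "nat \<Rightarrow> (nat \<Rightarrow> nat) \<Rightarrow> token set" where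
  "tokens N len = (SIGMA d:{1..N}. {1..len d})"

definition assignments :: "token set \<Rightarrow> nat \<Rightarrow> (token \<Rightarrow> nat) set" where
  "assignments S T = S \<rightarrow>\<^sub>E {1..T}"

definition remove_token ::
    "nat \<Rightarrow> (nat \<Rightarrow> nat) \<Rightarrow> token \<Rightarrow> (token \<Rightarrow> nat) \<Rightarrow> (token \<Rightarrow> nat)" where
  "remove_token N len x z = restrict z (tokens N len - {x})"

text \<open>The counts never look at the token that is left out, so they take an
  assignment of all the remaining tokens as their last argument.\<close>

definition doc_count :: "(nat \<Rightarrow> nat) \<Rightarrow> token \<Rightarrow> nat \<Rightarrow> (token \<Rightarrow> nat) \<Rightarrow> nat" where
  "doc_count len x t z = card {j \<in> {1..len (fst x)}. j \<noteq> snd x \<and> z (fst x, j) = t}"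

definition word_count ::
    "nat \<Rightarrow> (nat \<Rightarrow> nat) \<Rightarrow> (token \<Rightarrow> nat) \<Rightarrow> token \<Rightarrow> nat \<Rightarrow> nat \<Rightarrow> (token \<Rightarrow> nat) \<Rightarrow> nat" where
  "word_count N len w x t v z = card {y \<in> tokens N len. y \<noteq> x \<and> w y = v \<and> z y = t}"

definition topic_count ::
    "nat \<Rightarrow> (nat \<Rightarrow> nat) \<Rightarrow> nat \<Rightarrow> (token \<Rightarrow> nat) \<Rightarrow> token \<Rightarrow> nat \<Rightarrow> (token \<Rightarrow> nat) \<Rightarrow> nat" where
  "topic_count N len V w x t z = (\<Sum>v\<in>{1..V}. word_count N len w x t v z)"


section \<open>Alpha-divergence\<close>

text \<open>Only used for nonnegative functions with the same support in \<open>Z\<close> and for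
  \<open>\<alpha> \<noteq> 0\<close>. The value at \<open>\<alpha> = 1\<close> is the limit, see \<open>alpha_div_tendsto_1\<close> below.\<close>

definition alpha_div :: "'a set \<Rightarrow> real \<Rightarrow> ('a \<Rightarrow> real) \<Rightarrow> ('a \<Rightarrow> real) \<Rightarrow> real" where
  "alpha_div Z \<alpha> p q =
    (let S = {z \<in> Z. p z \<noteq> 0 \<and> q z \<noteq> 0} in
     if \<alpha> = 1 then (\<Sum>z\<in>S. p z * ln (p z / q z)) + (\<Sum>z\<in>S. q z - p z)
     else (\<Sum>z\<in>S. \<alpha> * p z + (1 - \<alpha>) * q z - p z powr \<alpha> * q z powr (1 - \<alpha>))
            / (\<alpha> * (1 - \<alpha>)))"

lemma alpha_div_term_tendsto_1:
  fixes p q :: real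
  assumes "p > 0" "q > 0"
  shows "((\<lambda>\<alpha>. (\<alpha> * p + (1 - \<alpha>) * q - p powr \<alpha> * q powr (1 - \<alpha>)) / (\<alpha> * (1 - \<alpha>)))
    \<longlongrightarrow> p * ln (p / q) + (q - p)) (at 1)"
proof -
  have "((\<lambda>\<alpha>. \<alpha> * p + (1 - \<alpha>) * q - p powr \<alpha> * q powr (1 - \<alpha>)) has_real_derivative
      (p - q - (p * ln p - p * ln q))) (at 1)"
    using assms by (auto intro!: derivative_eq_intros simp: algebra_simps)
  then have "((\<lambda>\<alpha>. (\<alpha> * p + (1 - \<alpha>) * q - p powr \<alpha> * q powr (1 - \<alpha>)) / (\<alpha> - 1))
      \<longlongrightarrow> p - q - (p * ln p - p * ln q)) (at 1)"
    using assms by (simp add: has_field_derivative_iff)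
  then have "((\<lambda>\<alpha>. (\<alpha> * p + (1 - \<alpha>) * q - p powr \<alpha> * q powr (1 - \<alpha>)) / (\<alpha> - 1) * (- 1 / \<alpha>))
      \<longlongrightarrow> (p - q - (p * ln p - p * ln q)) * (- 1 / 1)) (at 1)"
    by (intro tendsto_intros) auto
  moreover have *: "x / (\<alpha> - 1) * (- 1 / \<alpha>) = x / (\<alpha> * (1 - \<alpha>))" for x \<alpha> :: real
    by (cases "\<alpha> = 0 \<or> \<alpha> = 1") (auto simp: divide_simps algebra_simps)
  moreover have "(p - q - (p * ln p - p * ln q)) * (- 1 / 1) = p * ln (p / q) + (q - p)"
    using assms by (simp add: ln_div algebra_simps)
  ultimately show ?thesis
    by (simp only: *)
qed

lemma alpha_div_tendsto_1:
  assumes "\<And>z. z \<in> Z \<Longrightarrow> p z \<ge> 0" "\<And>z. z \<in> Z \<Longrightarrow> q z \<ge> 0"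
  shows "((\<lambda>\<alpha>. alpha_div Z \<alpha> p q) \<longlongrightarrow> alpha_div Z 1 p q) (at 1)"
proof -
  let ?S = "{z \<in> Z. p z \<noteq> 0 \<and> q z \<noteq> 0}"
  let ?f = "\<lambda>\<alpha> z. \<alpha> * p z + (1 - \<alpha>) * q z - p z powr \<alpha> * q z powr (1 - \<alpha>)"
  have "((\<lambda>\<alpha>. \<Sum>z\<in>?S. ?f \<alpha> z / (\<alpha> * (1 - \<alpha>))) \<longlongrightarrow>
      (\<Sum>z\<in>?S. p z * ln (p z / q z) + (q z - p z))) (at 1)"
  proof (rule tendsto_sum)
    fix z assume "z \<in> ?S"
    then have "p z > 0" "q z > 0"
      using assms[of z] by (simp_all add: less_le)
    then show "((\<lambda>\<alpha>. ?f \<alpha> z / (\<alpha> * (1 - \<alpha>))) \<longlongrightarrow>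
        p z * ln (p z / q z) + (q z - p z)) (at 1)"
      by (rule alpha_div_term_tendsto_1)
  qed
  moreover have "(\<Sum>z\<in>?S. p z * ln (p z / q z) + (q z - p z)) = alpha_div Z 1 p q"
    by (simp add: alpha_div_def Let_def sum.distrib)
  moreover have *: "\<forall>\<^sub>F \<alpha> in at 1. (\<Sum>z\<in>?S. ?f \<alpha> z / (\<alpha> * (1 - \<alpha>))) = alpha_div Z \<alpha> p q"
    by (auto simp: eventually_at_filter alpha_div_def Let_def sum_divide_distrib)
  ultimately show ?thesis
    by (simp only: tendsto_cong[OF *])
qed


section \<open>Local projection and topic updates\<close>

definition pos_funs :: "nat \<Rightarrow> (nat \<Rightarrow> real) set" where
  "pos_funs T = {1..T} \<rightarrow>\<^sub>E {0<..}"

text \<open>The fully factorized distribution of the assignments of all tokens but \<open>x\<close>,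
  with factors \<open>q y\<close>. Its default value \<open>undefined\<close> matches that of \<^const>\<open>restrict\<close>.\<close>

definition q_rest ::
    "nat \<Rightarrow> (nat \<Rightarrow> nat) \<Rightarrow> (token \<Rightarrow> nat pmf) \<Rightarrow> token \<Rightarrow> (token \<Rightarrow> nat) pmf" where
  "q_rest N len q x = Pi_pmf (tokens N len - {x}) undefined q"

definition E_rest ::
    "nat \<Rightarrow> (nat \<Rightarrow> nat) \<Rightarrow> (token \<Rightarrow> nat pmf) \<Rightarrow> token \<Rightarrow> ((token \<Rightarrow> nat) \<Rightarrow> real) \<Rightarrow> real" where
  "E_rest N len q x f = measure_pmf.expectation (q_rest N len q x) f"

definition q_without ::
    "nat \<Rightarrow> (nat \<Rightarrow> nat) \<Rightarrow> (token \<Rightarrow> nat pmf) \<Rightarrow> token \<Rightarrow> (nat \<Rightarrow> real) \<Rightarrow> (nat \<Rightarrow> real)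
      \<Rightarrow> (token \<Rightarrow> nat) \<Rightarrow> real" where
  "q_without N len q x g h z =
    g (z x) * h (z x) * pmf (q_rest N len q x) (remove_token N len x z)"

text \<open>The divergence minimized over \<open>r\<close>: the exact factor \<open>f\<close>, which depends on the topic
  of \<open>x\<close> and on the remaining assignment, is replaced by \<open>r\<close>, which depends on the
  topic of \<open>x\<close> only; \<open>g\<close> and \<open>h\<close> are the two factors that are kept.\<close>

definition factor_div ::
    "nat \<Rightarrow> (nat \<Rightarrow> nat) \<Rightarrow> nat \<Rightarrow> (token \<Rightarrow> nat pmf) \<Rightarrow> token \<Rightarrow> real
      \<Rightarrow> (nat \<Rightarrow> (token \<Rightarrow> nat) \<Rightarrow> real) \<Rightarrow> (nat \<Rightarrow> real) \<Rightarrow> (nat \<Rightarrow> real) \<Rightarrow> (nat \<Rightarrow> real) \<Rightarrow> real" where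
  "factor_div N len T q x \<alpha> f g h r =
    alpha_div (assignments (tokens N len) T) \<alpha>
      (\<lambda>z. f (z x) (remove_token N len x z) * q_without N len q x g h z)
      (\<lambda>z. r (z x) * q_without N len q x g h z)"

definition topic_update :: "nat \<Rightarrow> (nat \<Rightarrow> real) \<Rightarrow> nat pmf \<Rightarrow> bool" where
  "topic_update T f r \<longleftrightarrow> set_pmf r \<subseteq> {1..T} \<and> (\<exists>K. \<forall>t\<in>{1..T}. pmf r t = K * f t)"

definition cvb0_update ::
    "nat \<Rightarrow> (nat \<Rightarrow> nat) \<Rightarrow> nat \<Rightarrow> nat \<Rightarrow> (token \<Rightarrow> nat) \<Rightarrow> (nat \<Rightarrow> real) \<Rightarrow> real
      \<Rightarrow> (token \<Rightarrow> nat pmf) \<Rightarrow> token \<Rightarrow> nat pmf \<Rightarrow> bool" where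
  "cvb0_update N len V T w \<gamma> \<beta> q x r \<longleftrightarrow>
    topic_update T
      (\<lambda>t. (\<beta> + E_rest N len q x (\<lambda>z. real (word_count N len w x t (w x) z)))
           / (real V * \<beta> + E_rest N len q x (\<lambda>z. real (topic_count N len V w x t z)))
           * (\<gamma> t + E_rest N len q x (\<lambda>z. real (doc_count len x t z)))) r"

end

theory Submission
  imports Defs
begin

text \<open>Summing out the topic of the token \<open>x\<close> splits the divergence into independent terms
  \<open>g t * h t * E [D(f t z, r t)]\<close>, where \<open>D\<close> is the divergence of two positive numbers.
  For the power mean \<open>m = E [f^\<alpha>]^(1/\<alpha>)\<close> one has the Pythagorean identity
  \<open>E [D(f, s)] = E [D(f, m)] + D(m, s)\<close>, and \<open>D(m, s) > 0\<close> unless \<open>s = m\<close>.\<close>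

section \<open>Divergence of two positive numbers\<close>

definition scalar_div :: "real \<Rightarrow> real \<Rightarrow> real \<Rightarrow> real" where
  "scalar_div \<alpha> p q =
    (if \<alpha> = 1 then p * ln (p / q) + (q - p)
     else (\<alpha> * p + (1 - \<alpha>) * q - p powr \<alpha> * q powr (1 - \<alpha>)) / (\<alpha> * (1 - \<alpha>)))"

text \<open>Homogeneity of degree one: the powers of \<open>c\<close> combine to
  \<open>c powr \<alpha> * c powr (1 - \<alpha>) = c\<close>. The case \<open>c = 0\<close> also
  holds, since \<open>0 powr u = 0\<close> makes both sides vanish.\<close>

lemma scalar_div_scale:
  assumes "p > 0" "q > 0" "c \<ge> 0"
  shows "scalar_div \<alpha> (p * c) (q * c) = c * scalar_div \<alpha> p q"
proof (cases "c = 0")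
  case True
  then show ?thesis by (simp add: scalar_div_def)
next
  case False
  then have "(p * c) powr \<alpha> * (q * c) powr (1 - \<alpha>)
      = p powr \<alpha> * q powr (1 - \<alpha>) * (c powr \<alpha> * c powr (1 - \<alpha>))"
    using assms by (simp add: powr_mult)
  also have "c powr \<alpha> * c powr (1 - \<alpha>) = c"
    using assms False by (simp flip: powr_add)
  finally have *: "(p * c) powr \<alpha> * (q * c) powr (1 - \<alpha>) = c * (p powr \<alpha> * q powr (1 - \<alpha>))"
    by simp
  have "\<alpha> * (p * c) + (1 - \<alpha>) * (q * c) - c * (p powr \<alpha> * q powr (1 - \<alpha>))
      = c * (\<alpha> * p + (1 - \<alpha>) * q - p powr \<alpha> * q powr (1 - \<alpha>))"
    by (simp add: algebra_simps)
  with False show ?thesis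
    unfolding scalar_div_def * by (simp add: algebra_simps)
qed

lemma scalar_div_self:
  assumes "p > 0"
  shows "scalar_div \<alpha> p p = 0"
  using assms by (simp add: scalar_div_def algebra_simps flip: powr_add)

text \<open>For \<alpha> = 1 this is the strict form of \<open>ln y \<le> y - 1\<close> at
  \<open>y = 1 / x\<close>, where equality would force \<open>x = 1\<close>. Otherwise the
  divergence from 1, as a function of its first argument, vanishes at 1, decreases before 1 and
  increases after it; the mean value theorem between \<open>x\<close> and 1 turns this into
  positivity.\<close>

lemma scalar_div_one_pos:
  assumes "x > 0" "x \<noteq> 1" "\<alpha> \<noteq> 0"
  shows "scalar_div \<alpha> x 1 > 0"
proof (cases "\<alpha> = 1")
  case True
  have "ln (1 / x) \<le> 1 / x - 1" "ln (1 / x) \<noteq> 1 / x - 1"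
    using ln_le_minus_one[of "1 / x"] ln_eq_minus_one[of "1 / x"] assms by auto
  then have "x * ln (1 / x) < x * (1 / x - 1)"
    using assms by simp
  also have "\<dots> = 1 - x"
    using assms by (simp add: algebra_simps)
  finally show ?thesis
    using assms True by (simp add: scalar_div_def ln_div)
next
  case False
  \<comment> \<open>\<open>h y\<close> is the divergence of \<open>y\<close> and 1, and
    \<open>h'\<close> is its derivative after \<alpha> has been cancelled.\<close>
  define h where "h = (\<lambda>y. (\<alpha> * y + (1 - \<alpha>) - y powr \<alpha>) / (\<alpha> * (1 - \<alpha>)))"
  define h' where "h' = (\<lambda>y::real. (1 - y powr (\<alpha> - 1)) / (1 - \<alpha>))"
  have deriv: "(h has_real_derivative h' y) (at y)" if "y > 0" for y
  proof -
    have "(h has_real_derivative (\<alpha> - \<alpha> * y powr (\<alpha> - 1)) / (\<alpha> * (1 - \<alpha>))) (at y)"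
      unfolding h_def using that by (auto intro!: derivative_eq_intros simp: assms False)
    \<comment> \<open>The factor \<alpha> cancels against the denominator, so negative \<alpha>
      needs no separate treatment.\<close>
    also have "\<alpha> - \<alpha> * y powr (\<alpha> - 1) = \<alpha> * (1 - y powr (\<alpha> - 1))"
      by (simp add: algebra_simps)
    finally show ?thesis
      using assms False by (simp add: h'_def)
  qed
  \<comment> \<open>The numerator of \<open>h'\<close> and its denominator
    \<open>1 - \<alpha>\<close> change sign together as \<alpha> passes 1, so the sign of
    \<open>h' y\<close> depends only on the side of 1 on which \<open>y\<close> lies.\<close>
  have sgn_gt: "h' y > 0" if "y > 1" for y
  proof (cases "\<alpha> > 1")
    case True
    then have "y powr (\<alpha> - 1) > 1" using that by simp
    with True show ?thesis by (simp add: h'_def divide_neg_neg)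
  next
    case less: False
    then have "y powr (\<alpha> - 1) < y powr 0"
      using that False by (intro powr_less_mono) auto
    with less False that show ?thesis by (simp add: h'_def)
  qed
  have sgn_lt: "h' y < 0" if "y > 0" "y < 1" for y
  proof (cases "\<alpha> > 1")
    case True
    then have "y powr (\<alpha> - 1) < y powr 0"
      using that by (intro powr_less_mono') auto
    with True that show ?thesis by (simp add: h'_def divide_pos_neg)
  next
    case less: False
    then have "y powr (\<alpha> - 1) > y powr 0"
      using that False by (intro powr_less_mono') auto
    with less False that show ?thesis by (simp add: h'_def divide_neg_pos)
  qed
  have h1: "h 1 = 0" by (simp add: h_def)
  have "h x > 0"
  proof (cases "x > 1")
    case True
    then obtain y where "y > 1" "h x - h 1 = (x - 1) * h' y"
      using MVT2[of 1 x h h'] deriv by auto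
    with True h1 sgn_gt[of y] show ?thesis by simp
  next
    case False
    with assms have "x < 1" by simp
    then obtain y where "y > x" "y < 1" "h 1 - h x = (1 - x) * h' y"
      using MVT2[of x 1 h h'] deriv assms by auto
    moreover from this have "h' y < 0"
      using assms by (intro sgn_lt) auto
    ultimately show ?thesis
      using \<open>x < 1\<close> h1 mult_pos_neg[of "1 - x" "h' y"] by simp
  qed
  then show ?thesis
    using False by (simp add: scalar_div_def h_def)
qed

text \<open>Homogeneity divides out \<open>q\<close> and leaves the divergence of
  \<open>p / q\<close> from 1.\<close>

lemma scalar_div_pos:
  assumes "p > 0" "q > 0" "p \<noteq> q" "\<alpha> \<noteq> 0"
  shows "scalar_div \<alpha> p q > 0"
proof -
  have "scalar_div \<alpha> p q = q * scalar_div \<alpha> (p / q) 1"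
    using scalar_div_scale[of "p / q" 1 q \<alpha>] assms by simp
  then show ?thesis
    using scalar_div_one_pos[of "p / q" \<alpha>] assms by simp
qed

text \<open>Homogeneity pulls the common factor \<open>c\<close> out of every summand. Where
  \<open>c\<close> vanishes, the point lies outside the support on the left and contributes 0 on the
  right, so the restriction to the support disappears.\<close>

lemma alpha_div_eq_sum_scalar_div:
  assumes "finite Z"
    and "\<And>z. z \<in> Z \<Longrightarrow> f z > 0" "\<And>z. z \<in> Z \<Longrightarrow> r z > 0" "\<And>z. z \<in> Z \<Longrightarrow> c z \<ge> 0"
  shows "alpha_div Z \<alpha> (\<lambda>z. f z * c z) (\<lambda>z. r z * c z) = (\<Sum>z\<in>Z. c z * scalar_div \<alpha> (f z) (r z))"
proof -
  let ?S = "{z \<in> Z. f z * c z \<noteq> 0 \<and> r z * c z \<noteq> 0}"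
  have "alpha_div Z \<alpha> (\<lambda>z. f z * c z) (\<lambda>z. r z * c z)
      = (\<Sum>z\<in>?S. scalar_div \<alpha> (f z * c z) (r z * c z))"
    by (simp add: alpha_div_def scalar_div_def Let_def sum.distrib sum_divide_distrib)
  also have "\<dots> = (\<Sum>z\<in>?S. c z * scalar_div \<alpha> (f z) (r z))"
    using assms by (intro sum.cong) (auto simp: scalar_div_scale)
  also have "\<dots> = (\<Sum>z\<in>Z. c z * scalar_div \<alpha> (f z) (r z))"
    using assms by (intro sum.mono_neutral_left) fastforce+
  finally show ?thesis .
qed

section \<open>Expected divergence and the power mean\<close>

lemma integral_pmf_pos:
  fixes f :: "'a \<Rightarrow> real"
  assumes "finite (set_pmf M)" "\<And>y. y \<in> set_pmf M \<Longrightarrow> f y > 0"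
  shows "measure_pmf.expectation M f > 0"
proof -
  have "measure_pmf.expectation M f = (\<Sum>y\<in>set_pmf M. f y * pmf M y)"
    using assms(1) by (intro integral_measure_pmf_real) auto
  also have "\<dots> > 0"
    using assms by (intro sum_pos) (auto simp: set_pmf_not_empty pmf_positive)
  finally show ?thesis .
qed

text \<open>As a function of its second argument \<open>u\<close>, the expected divergence involves
  the law of \<open>f\<close> only through the moment \<open>m powr \<alpha>\<close>, up to a
  constant. Subtracting its values at \<open>u = s\<close> and \<open>u = m\<close> cancels that
  constant, and the difference is the divergence of \<open>m\<close> and \<open>s\<close>.\<close>

lemma expectation_scalar_div:
  fixes f :: "'a \<Rightarrow> real"
  assumes fin: "finite (set_pmf M)" and f: "\<And>y. f y > 0" and "s > 0" "\<alpha> \<noteq> 0"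
  defines "m \<equiv> measure_pmf.expectation M (\<lambda>y. f y powr \<alpha>) powr (1 / \<alpha>)"
  shows "measure_pmf.expectation M (\<lambda>y. scalar_div \<alpha> (f y) s)
    = measure_pmf.expectation M (\<lambda>y. scalar_div \<alpha> (f y) m) + scalar_div \<alpha> m s"
proof -
  note [simp] = integrable_measure_pmf_finite[OF fin]
  have pos: "measure_pmf.expectation M (\<lambda>y. f y powr \<alpha>) > 0"
    using f by (intro integral_pmf_pos fin) (auto simp: less_le)
  have m: "m > 0" using pos by (simp add: m_def)
  have m\<alpha>: "measure_pmf.expectation M (\<lambda>y. f y powr \<alpha>) = m powr \<alpha>"
    using pos \<open>\<alpha> \<noteq> 0\<close> by (simp add: m_def powr_powr)
  show ?thesis
  proof (cases "\<alpha> = 1")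
    case True
    then have Ef: "measure_pmf.expectation M f = m"
      using m\<alpha> m f by (simp add: less_imp_le)
    \<comment> \<open>The expectation of \<open>f ln f\<close> does not depend on \<open>u\<close>,
      so it cancels in the comparison of \<open>u = s\<close> with \<open>u = m\<close>.\<close>
    have E: "measure_pmf.expectation M (\<lambda>y. scalar_div \<alpha> (f y) u)
        = measure_pmf.expectation M (\<lambda>y. f y * ln (f y)) - m * ln u + u - m" if "u > 0" for u
    proof -
      have "scalar_div \<alpha> (f y) u = f y * ln (f y) - f y * ln u + u - f y" for y
        using that f[of y] True by (simp add: scalar_div_def ln_div algebra_simps)
      then show ?thesis by (simp add: Ef)
    qed
    show ?thesis
      using m \<open>s > 0\<close> True unfolding E[OF m] E[OF \<open>s > 0\<close>]
      by (simp add: scalar_div_def ln_div algebra_simps)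
  next
    case False
    have E: "measure_pmf.expectation M (\<lambda>y. scalar_div \<alpha> (f y) u)
        = (\<alpha> * measure_pmf.expectation M f + (1 - \<alpha>) * u - m powr \<alpha> * u powr (1 - \<alpha>)) / (\<alpha> * (1 - \<alpha>))"
      for u
      using False by (simp add: scalar_div_def m\<alpha>)
    \<comment> \<open>At \<open>u = m\<close> the mixed term of \<open>E\<close> collapses to
      \<open>m\<close>, which supplies the linear term in \<open>m\<close> of the divergence of
      \<open>m\<close> and \<open>s\<close>.\<close>
    have "m powr \<alpha> * m powr (1 - \<alpha>) = m"
      using m by (simp flip: powr_add)
    then show ?thesis
      using False unfolding E
      by (simp add: scalar_div_def algebra_simps flip: add_divide_distrib)
  qed
qed

section \<open>Summing out the topic of one token\<close>

lemma finite_tokens: "finite (tokens N len)"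
  by (simp add: tokens_def)

lemma set_q_rest_subset:
  assumes "\<forall>y\<in>tokens N len - {x}. set_pmf (q y) \<subseteq> {1..T}"
  shows "set_pmf (q_rest N len q x) \<subseteq> assignments (tokens N len - {x}) T"
  using assms finite_tokens[of N len]
  by (fastforce simp: q_rest_def set_Pi_pmf PiE_dflt_def assignments_def PiE_iff extensional_def)

lemma finite_assignments: "finite S \<Longrightarrow> finite (assignments S T)"
  by (simp add: assignments_def finite_PiE)

text \<open>An assignment corresponds to the pair of the topic of \<open>x\<close> and the
  assignment of the other tokens; the inverse map is the update \<open>y(x := t)\<close>.\<close>

lemma sum_assignments_split:
  assumes "x \<in> tokens N len"
  shows "(\<Sum>z\<in>assignments (tokens N len) T. F (z x) (remove_token N len x z))
    = (\<Sum>t\<in>{1..T}. \<Sum>y\<in>assignments (tokens N len - {x}) T. F t y)"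
proof -
  let ?S = "tokens N len - {x}"
  have "(\<Sum>z\<in>assignments (tokens N len) T. F (z x) (remove_token N len x z))
      = (\<Sum>(t, y)\<in>{1..T} \<times> assignments ?S T. F t y)"
  proof (rule sum.reindex_bij_witness[where
        i = "\<lambda>(t, y). y(x := t)" and j = "\<lambda>z. (z x, remove_token N len x z)"])
    fix z assume z: "z \<in> assignments (tokens N len) T"
    then show "(z x, remove_token N len x z) \<in> {1..T} \<times> assignments ?S T"
      using assms by (auto simp: assignments_def remove_token_def PiE_iff)
    \<comment> \<open>Outside the corpus \<open>restrict\<close> returns \<open>undefined\<close>,
      so \<open>z\<close> is recovered there only because it is extensional.\<close>
    have "z y = undefined" if "y \<notin> tokens N len" for y
      using z that unfolding assignments_def by (rule PiE_arb)
    then show "(case (z x, remove_token N len x z) of (t, y) \<Rightarrow> y(x := t)) = z"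
      by (auto simp: remove_token_def restrict_def fun_eq_iff)
  next
    fix p assume "p \<in> {1..T} \<times> assignments ?S T"
    then obtain t y where p: "p = (t, y)" "t \<in> {1..T}" and y: "y \<in> ?S \<rightarrow>\<^sub>E {1..T}"
      by (auto simp: assignments_def)
    have "y(x := t) \<in> insert x ?S \<rightarrow>\<^sub>E {1..T}"
      using p y by (intro PiE_fun_upd)
    then show "(case p of (t, y) \<Rightarrow> y(x := t)) \<in> assignments (tokens N len) T"
      using assms p by (simp add: assignments_def insert_absorb)
    have "remove_token N len x (y(x := t)) = restrict y ?S"
      unfolding remove_token_def by (intro restrict_ext) simp
    also have "\<dots> = y"
      using y by (rule PiE_restrict)
    finally show "((case p of (t, y) \<Rightarrow> y(x := t)) x,
        remove_token N len x (case p of (t, y) \<Rightarrow> y(x := t))) = p"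
      using p by simp
  qed simp
  then show ?thesis
    by (simp add: sum.cartesian_product)
qed

lemma pos_funs_pos: "g \<in> pos_funs T \<Longrightarrow> t \<in> {1..T} \<Longrightarrow> g t > 0"
  by (auto simp: pos_funs_def)

text \<open>Separates the minimization: \<open>r t\<close> occurs in the summand of the topic
  \<open>t\<close> alone, with the weight \<open>g t * h t > 0\<close>. The probabilities of the
  remaining assignments turn the inner sum into an expectation.\<close>

lemma factor_div_eq:
  assumes x: "x \<in> tokens N len"
    and q: "\<forall>y\<in>tokens N len - {x}. set_pmf (q y) \<subseteq> {1..T}"
    and f: "\<forall>t\<in>{1..T}. \<forall>y. f t y > 0"
    and "g \<in> pos_funs T" "h \<in> pos_funs T" "r \<in> pos_funs T"
  shows "factor_div N len T q x \<alpha> f g h r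
    = (\<Sum>t\<in>{1..T}. g t * h t * E_rest N len q x (\<lambda>z. scalar_div \<alpha> (f t z) (r t)))"
proof -
  let ?R = "q_rest N len q x" and ?A = "assignments (tokens N len - {x}) T"
  have zx: "z x \<in> {1..T}" if "z \<in> assignments (tokens N len) T" for z
    using that x unfolding assignments_def by blast
  have "factor_div N len T q x \<alpha> f g h r
      = (\<Sum>z\<in>assignments (tokens N len) T. q_without N len q x g h z
          * scalar_div \<alpha> (f (z x) (remove_token N len x z)) (r (z x)))"
    unfolding factor_div_def
  proof (rule alpha_div_eq_sum_scalar_div)
    show "finite (assignments (tokens N len) T)"
      by (intro finite_assignments finite_tokens)
  next
    fix z assume z: "z \<in> assignments (tokens N len) T"
    note pos = pos_funs_pos[OF _ zx[OF z]]
    show "f (z x) (remove_token N len x z) > 0" using f zx[OF z] by blast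
    show "r (z x) > 0" by (rule pos) fact
    show "q_without N len q x g h z \<ge> 0"
      using pos[OF assms(4)] pos[OF assms(5)] by (simp add: q_without_def less_imp_le)
  qed
  also have "\<dots> = (\<Sum>t\<in>{1..T}. \<Sum>y\<in>?A. g t * h t * pmf ?R y * scalar_div \<alpha> (f t y) (r t))"
    unfolding q_without_def using sum_assignments_split[OF x] .
  also have "\<dots> = (\<Sum>t\<in>{1..T}. g t * h t * E_rest N len q x (\<lambda>z. scalar_div \<alpha> (f t z) (r t)))"
  proof (rule sum.cong)
    fix t
    \<comment> \<open>The finite set \<open>?A\<close> contains the support of \<open>?R\<close>, so
      the expectation is a sum over \<open>?A\<close>; assignments of probability 0 add
      nothing.\<close>
    have "E_rest N len q x (\<lambda>z. scalar_div \<alpha> (f t z) (r t))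
        = (\<Sum>y\<in>?A. scalar_div \<alpha> (f t y) (r t) * pmf ?R y)"
      unfolding E_rest_def using set_q_rest_subset[OF q]
      by (intro integral_measure_pmf_real finite_assignments) (auto simp: finite_tokens)
    then show "(\<Sum>y\<in>?A. g t * h t * pmf ?R y * scalar_div \<alpha> (f t y) (r t))
        = g t * h t * E_rest N len q x (\<lambda>z. scalar_div \<alpha> (f t z) (r t))"
      by (simp add: sum_distrib_left mult_ac)
  qed simp
  finally show ?thesis .
qed

lemma finite_set_q_rest:
  assumes "\<forall>y\<in>tokens N len - {x}. set_pmf (q y) \<subseteq> {1..T}"
  shows "finite (set_pmf (q_rest N len q x))"
  using set_q_rest_subset[OF assms] finite_assignments[of "tokens N len - {x}" T]
  by (auto simp: finite_tokens intro: finite_subset)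

section \<open>Unique minimizer of the local divergence\<close>

text \<open>Covers all three factors at once, as \<open>f\<close> is an arbitrary positive function.
  Weighting the Pythagorean identity by \<open>g t * h t\<close> and summing over the topics shows
  that the excess of \<open>r\<close> over \<open>?m\<close> is a sum of nonnegative terms, one of
  them positive unless \<open>r = ?m\<close>. The kept factors \<open>g\<close> and \<open>h\<close>
  do not affect the minimizer.\<close>

lemma is_arg_min_factor_div_iff:
  assumes x: "x \<in> tokens N len"
    and q: "\<forall>y\<in>tokens N len - {x}. set_pmf (q y) \<subseteq> {1..T}"
    and f: "\<forall>t\<in>{1..T}. \<forall>y. f t y > 0"
    and gh: "g \<in> pos_funs T" "h \<in> pos_funs T" and "\<alpha> \<noteq> 0"
  shows "is_arg_min (factor_div N len T q x \<alpha> f g h) (\<lambda>r. r \<in> pos_funs T) r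
    \<longleftrightarrow> r = (\<lambda>t\<in>{1..T}. E_rest N len q x (\<lambda>z. f t z powr \<alpha>) powr (1 / \<alpha>))"
    (is "is_arg_min ?F ?P r \<longleftrightarrow> r = ?m")
proof -
  have fin: "finite (set_pmf (q_rest N len q x))"
    by (rule finite_set_q_rest[OF q])
  have "E_rest N len q x (\<lambda>z. f t z powr \<alpha>) > 0" if "t \<in> {1..T}" for t
    unfolding E_rest_def using f that by (intro integral_pmf_pos fin) (auto simp: less_le)
  then have m: "?m \<in> pos_funs T"
    by (auto simp: pos_funs_def less_le)
  have pyth: "?F r = ?F ?m + (\<Sum>t\<in>{1..T}. g t * h t * scalar_div \<alpha> (?m t) (r t))"
    if r: "r \<in> pos_funs T" for r
  proof -
    have "E_rest N len q x (\<lambda>z. scalar_div \<alpha> (f t z) (r t))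
        = E_rest N len q x (\<lambda>z. scalar_div \<alpha> (f t z) (?m t)) + scalar_div \<alpha> (?m t) (r t)"
      if t: "t \<in> {1..T}" for t
      using expectation_scalar_div[OF fin f[rule_format, OF t] pos_funs_pos[OF r t] \<open>\<alpha> \<noteq> 0\<close>] t
      by (simp add: E_rest_def)
    then have "?F r = (\<Sum>t\<in>{1..T}. g t * h t *
        (E_rest N len q x (\<lambda>z. scalar_div \<alpha> (f t z) (?m t)) + scalar_div \<alpha> (?m t) (r t)))"
      unfolding factor_div_eq[OF x q f gh r] by (intro sum.cong) auto
    then show ?thesis
      unfolding factor_div_eq[OF x q f gh m] by (simp only: distrib_left sum.distrib)
  qed
  have term_nonneg: "g t * h t * scalar_div \<alpha> (?m t) (r t) \<ge> 0"
    if r: "r \<in> pos_funs T" and t: "t \<in> {1..T}" for r t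
    using scalar_div_pos[OF pos_funs_pos[OF m t] pos_funs_pos[OF r t] _ \<open>\<alpha> \<noteq> 0\<close>]
      scalar_div_self[OF pos_funs_pos[OF m t]] pos_funs_pos[OF gh(1) t] pos_funs_pos[OF gh(2) t]
    by (cases "?m t = r t") (auto intro!: mult_nonneg_nonneg simp del: restrict_apply)
  have min: "?F ?m \<le> ?F r" if r: "r \<in> pos_funs T" for r
    unfolding pyth[OF r] by (simp only: le_add_same_cancel1) (intro sum_nonneg term_nonneg[OF r])
  have strict: "?F ?m < ?F r" if r: "r \<in> pos_funs T" and ne: "r \<noteq> ?m" for r
  proof -
    \<comment> \<open>Both functions are extensional on \<open>{1..T}\<close>, so if they differ,
      they differ at some topic.\<close>
    obtain t where t: "t \<in> {1..T}" "?m t \<noteq> r t"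
      using PiE_ext[of r "{1..T}" "\<lambda>_. {0<..}" ?m] r m ne unfolding pos_funs_def by metis
    have "g t * h t * scalar_div \<alpha> (?m t) (r t) > 0"
      using scalar_div_pos[OF pos_funs_pos[OF m t(1)] pos_funs_pos[OF r t(1)] t(2) \<open>\<alpha> \<noteq> 0\<close>]
        pos_funs_pos[OF gh(1) t(1)] pos_funs_pos[OF gh(2) t(1)] by (intro mult_pos_pos)
    then have "(\<Sum>t\<in>{1..T}. g t * h t * scalar_div \<alpha> (?m t) (r t)) > 0"
      using t(1) term_nonneg[OF r] by (intro sum_pos2[of _ t]) auto
    then show ?thesis unfolding pyth[OF r] by simp
  qed
  show ?thesis
    using m min strict unfolding is_arg_min_def by (metis not_less)
qed

section \<open>The three projections and the CVB0 update\<close>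

lemma topic_update_cong:
  assumes "\<And>t. t \<in> {1..T} \<Longrightarrow> f t = g t"
  shows "topic_update T f r \<longleftrightarrow> topic_update T g r"
  using assms by (simp add: topic_update_def)

text \<open>The first three conjuncts are instances of the general minimizer lemma. In the last one
  the kept factors may be chosen separately for each minimizer, because the minimizers do not depend
  on them. There \<alpha> = 1 gives arithmetic means, and \<alpha> = -1 applied to reciprocals gives
  the reciprocal of an arithmetic mean.\<close>

theorem mainTheorem1:
  fixes N V T d i v :: nat
    and len :: "nat \<Rightarrow> nat"
    and w :: "nat \<times> nat \<Rightarrow> nat"
    and \<gamma> :: "nat \<Rightarrow> real"
    and \<beta> \<alpha> :: real
    and q :: "nat \<times> nat \<Rightarrow> nat pmf"
  assumes di: "(d, i) \<in> tokens N len"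
    and w: "\<And>y. y \<in> tokens N len \<Longrightarrow> w y \<in> {1..V}"
    and v: "v = w (d, i)"
    and \<gamma>: "\<And>t. t \<in> {1..T} \<Longrightarrow> \<gamma> t > 0"
    and \<beta>: "\<beta> > 0"
    and q: "\<And>y. y \<in> tokens N len - {(d, i)} \<Longrightarrow> set_pmf (q y) \<subseteq> {1..T}"
    and \<alpha>: "\<alpha> \<noteq> 0"
  shows
    "(\<forall>b\<in>pos_funs T. \<forall>c\<in>pos_funs T. \<forall>a.
        is_arg_min
          (factor_div N len T q (d, i) \<alpha> (\<lambda>t z. real (doc_count len (d, i) t z) + \<gamma> t) b c)
          (\<lambda>a. a \<in> pos_funs T) a \<longleftrightarrow>
        a = (\<lambda>t\<in>{1..T}. E_rest N len q (d, i)
              (\<lambda>z. (real (doc_count len (d, i) t z) + \<gamma> t) powr \<alpha>) powr (1 / \<alpha>)))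
   \<and> (\<forall>a\<in>pos_funs T. \<forall>c\<in>pos_funs T. \<forall>b.
        is_arg_min
          (factor_div N len T q (d, i) \<alpha> (\<lambda>t z. real (word_count N len w (d, i) t v z) + \<beta>) a c)
          (\<lambda>b. b \<in> pos_funs T) b \<longleftrightarrow>
        b = (\<lambda>t\<in>{1..T}. E_rest N len q (d, i)
              (\<lambda>z. (real (word_count N len w (d, i) t v z) + \<beta>) powr \<alpha>) powr (1 / \<alpha>)))
   \<and> (\<forall>a\<in>pos_funs T. \<forall>b\<in>pos_funs T. \<forall>c.
        is_arg_min
          (factor_div N len T q (d, i) \<alpha>
            (\<lambda>t z. 1 / (real (topic_count N len V w (d, i) t z) + real V * \<beta>)) a b)
          (\<lambda>c. c \<in> pos_funs T) c \<longleftrightarrow>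
        c = (\<lambda>t\<in>{1..T}. E_rest N len q (d, i)
              (\<lambda>z. (1 / (real (topic_count N len V w (d, i) t z) + real V * \<beta>)) powr \<alpha>) powr (1 / \<alpha>)))
   \<and> (\<forall>a b c.
        (\<exists>b'\<in>pos_funs T. \<exists>c'\<in>pos_funs T. is_arg_min
          (factor_div N len T q (d, i) 1 (\<lambda>t z. real (doc_count len (d, i) t z) + \<gamma> t) b' c')
          (\<lambda>a. a \<in> pos_funs T) a) \<longrightarrow>
        (\<exists>a'\<in>pos_funs T. \<exists>c'\<in>pos_funs T. is_arg_min
          (factor_div N len T q (d, i) 1 (\<lambda>t z. real (word_count N len w (d, i) t v z) + \<beta>) a' c')
          (\<lambda>b. b \<in> pos_funs T) b) \<longrightarrow>
        (\<exists>a'\<in>pos_funs T. \<exists>b'\<in>pos_funs T. is_arg_min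
          (factor_div N len T q (d, i) (- 1)
            (\<lambda>t z. 1 / (real (topic_count N len V w (d, i) t z) + real V * \<beta>)) a' b')
          (\<lambda>c. c \<in> pos_funs T) c) \<longrightarrow>
        (\<forall>r. topic_update T (\<lambda>t. a t * b t * c t) r \<longleftrightarrow>
             cvb0_update N len V T w \<gamma> \<beta> q (d, i) r) \<and>
        (\<forall>t\<in>{1..T}. a t * b t * c t =
          (E_rest N len q (d, i) (\<lambda>z. real (doc_count len (d, i) t z)) + \<gamma> t) *
          ((E_rest N len q (d, i) (\<lambda>z. real (word_count N len w (d, i) t v z)) + \<beta>) /
           (E_rest N len q (d, i) (\<lambda>z. real (topic_count N len V w (d, i) t z)) + real V * \<beta>))))"
proof -
  have qT: "\<forall>y\<in>tokens N len - {(d, i)}. set_pmf (q y) \<subseteq> {1..T}"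
    using q by blast
  have fin: "finite (set_pmf (q_rest N len q (d, i)))"
    by (rule finite_set_q_rest[OF qT])
  \<comment> \<open>The word at \<open>(d, i)\<close> lies in \<open>{1..V}\<close>, hence
    \<open>V\<close> is not 0.\<close>
  have Vpos: "real V * \<beta> > 0"
    using w[OF di] \<beta> by auto
  have f1: "real (doc_count len (d, i) t z) + \<gamma> t > 0" if "t \<in> {1..T}" for t z
    using \<gamma>[OF that] by (simp add: add_nonneg_pos)
  then have f1': "\<forall>t\<in>{1..T}. \<forall>z. real (doc_count len (d, i) t z) + \<gamma> t > 0"
    by blast
  have f2: "real (word_count N len w (d, i) t v z) + \<beta> > 0" for t z
    using \<beta> by (simp add: add_nonneg_pos)
  have f3': "real (topic_count N len V w (d, i) t z) + real V * \<beta> > 0" for t z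
    using Vpos by (simp add: add_nonneg_pos)
  then have f3: "1 / (real (topic_count N len V w (d, i) t z) + real V * \<beta>) > 0" for t z
    by simp
  have E_add: "E_rest N len q (d, i) (\<lambda>z. u z + k) = E_rest N len q (d, i) u + k" for u k
    unfolding E_rest_def by (simp add: integrable_measure_pmf_finite[OF fin])
  have E_nonneg: "E_rest N len q (d, i) (\<lambda>z. real (u z)) \<ge> 0" for u
    unfolding E_rest_def by (intro Bochner_Integration.integral_nonneg) simp
  note M1 = is_arg_min_factor_div_iff[OF di qT f1']
  note M2 = is_arg_min_factor_div_iff[OF di qT, OF ballI, OF allI, OF f2]
  note M3 = is_arg_min_factor_div_iff[OF di qT, OF ballI, OF allI, OF f3]
  have prod_eq: "a t * b t * c t =
          (E_rest N len q (d, i) (\<lambda>z. real (doc_count len (d, i) t z)) + \<gamma> t) *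
          ((E_rest N len q (d, i) (\<lambda>z. real (word_count N len w (d, i) t v z)) + \<beta>) /
           (E_rest N len q (d, i) (\<lambda>z. real (topic_count N len V w (d, i) t z)) + real V * \<beta>))"
    if t: "t \<in> {1..T}"
      and a: "\<exists>b'\<in>pos_funs T. \<exists>c'\<in>pos_funs T. is_arg_min
          (factor_div N len T q (d, i) 1 (\<lambda>t z. real (doc_count len (d, i) t z) + \<gamma> t) b' c')
          (\<lambda>a. a \<in> pos_funs T) a"
      and b: "\<exists>a'\<in>pos_funs T. \<exists>c'\<in>pos_funs T. is_arg_min
          (factor_div N len T q (d, i) 1 (\<lambda>t z. real (word_count N len w (d, i) t v z) + \<beta>) a' c')
          (\<lambda>b. b \<in> pos_funs T) b"
      and c: "\<exists>a'\<in>pos_funs T. \<exists>b'\<in>pos_funs T. is_arg_min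
          (factor_div N len T q (d, i) (- 1)
            (\<lambda>t z. 1 / (real (topic_count N len V w (d, i) t z) + real V * \<beta>)) a' b')
          (\<lambda>c. c \<in> pos_funs T) c"
    for a b c t
  proof -
    \<comment> \<open>The simp rules for exponent 1 are held back so that both sides keep the shape
      of a power mean and match.\<close>
    have "a = (\<lambda>t\<in>{1..T}. E_rest N len q (d, i)
        (\<lambda>z. (real (doc_count len (d, i) t z) + \<gamma> t) powr 1) powr (1 / 1))"
      using a by (auto simp: M1 simp del: powr_one_eq_one powr_one)
    \<comment> \<open>Positivity removes the exponents 1, and linearity takes
      \<open>\<gamma> t\<close> out of the expectation.\<close>
    then have at: "a t = E_rest N len q (d, i) (\<lambda>z. real (doc_count len (d, i) t z)) + \<gamma> t"
      using t f1[OF t] E_nonneg[of "doc_count len (d, i) t"] \<gamma>[OF t] by (simp add: E_add less_imp_le)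
    have "b = (\<lambda>t\<in>{1..T}. E_rest N len q (d, i)
        (\<lambda>z. (real (word_count N len w (d, i) t v z) + \<beta>) powr 1) powr (1 / 1))"
      using b by (auto simp: M2 simp del: powr_one_eq_one powr_one)
    then have bt: "b t = E_rest N len q (d, i) (\<lambda>z. real (word_count N len w (d, i) t v z)) + \<beta>"
      using t f2[of t] E_nonneg[of "word_count N len w (d, i) t v"] \<beta>
      by (simp add: E_add less_imp_le)
    have "c = (\<lambda>t\<in>{1..T}. E_rest N len q (d, i)
        (\<lambda>z. (1 / (real (topic_count N len V w (d, i) t z) + real V * \<beta>)) powr (- 1)) powr (1 / (- 1)))"
      using c by (auto simp: M3)
    \<comment> \<open>The inner exponent -1 undoes the reciprocal, so the expectation is taken of
      the count itself; the outer exponent then inverts the result.\<close>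
    moreover have "(1 / (real (topic_count N len V w (d, i) t z) + real V * \<beta>)) powr (- 1)
        = real (topic_count N len V w (d, i) t z) + real V * \<beta>" for z
      using f3'[of t z] by (simp add: powr_minus)
    ultimately have ct: "c t =
        1 / (E_rest N len q (d, i) (\<lambda>z. real (topic_count N len V w (d, i) t z)) + real V * \<beta>)"
      using t E_nonneg[of "topic_count N len V w (d, i) t"] Vpos
      by (simp add: E_add powr_minus divide_inverse)
    show ?thesis unfolding at bt ct by simp
  qed
  show ?thesis
  proof (intro conjI allI impI ballI, goal_cases)
    case (1 b c a)
    then show ?case by (rule M1) (rule \<alpha>)
  next
    case (2 a c b)
    then show ?case by (rule M2) (rule \<alpha>)
  next
    case (3 a b c)
    then show ?case by (rule M3) (rule \<alpha>)
  next
    case (4 a b c r)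
    \<comment> \<open>Equal weights on \<open>{1..T}\<close> define the same update, so no
      normalizing constant has to be computed.\<close>
    have "a t * b t * c t =
        (\<beta> + E_rest N len q (d, i) (\<lambda>z. real (word_count N len w (d, i) t (w (d, i)) z)))
          / (real V * \<beta> + E_rest N len q (d, i) (\<lambda>z. real (topic_count N len V w (d, i) t z)))
          * (\<gamma> t + E_rest N len q (d, i) (\<lambda>z. real (doc_count len (d, i) t z)))"
      if "t \<in> {1..T}" for t
      unfolding prod_eq[OF that 4] v by (simp add: add.commute mult.commute)
    then show ?case
      unfolding cvb0_update_def by (rule topic_update_cong)
  next
    case (5 a b c t)
    show ?case by (rule prod_eq[OF 5(4) 5(1-3)])
  qed
qed

end
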